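(* Let $A=(a_n)_{n\ge1}$ be a strictly ascending sequence of non-negative integers and let $\mathfrak{n}(A)=\prod_{n\ge1}a_n$. Then for every generalized integer $\mathfrak{m}$ coprime with $\mathfrak{n}(A)$ there exists a simple Riesz group of rank one $G(\mathfrak{m})$ such that: (i) there is an unbounded countably generated interval $D\subseteq G(\mathfrak{m})^+$ with $nD\neq G(\mathfrak{m})^+$ for all $n\in\mathbb{N}$; (ii) for some generalized integer $\mathfrak{n}$ dividing $\mathfrak{n}(A)$, $G(\mathfrak{m})$ is isomorphic, as an abelian group, to $\mathbb{Z}_{\mathfrak{n}\cdot\mathfrak{m}}$.
   Context: Partially ordered abelian group $(G,G^+)$; simple: $G\neq0$ and every nonzero $u\in G^+$ is an order-unit. Riesz group: $x\le y_1+y_2$ in $G^+$ implies $x=x_1+x_2$ with $x_j\in G^+$, $x_j\le y_j$. Rank one: isomorphic to a nonzero subgroup of $\mathbb{Q}$. Generalized integers: maps from primes to $\{0,1,\dots,\infty\}$, products add exponents, $\prod_n a_n$ has at each prime the sum of the exponents in the $a_n$; $\mathfrak{n}\mid\mathfrak{m}$ if $\mathfrak{m}=\mathfrak{n}\mathfrak{n}'$; coprime: at each prime one exponent is $0$. $\mathbb{Z}_{\mathfrak{n}}=\{a/b\in\mathbb{Q}: b\mid\mathfrak{n}\}$. An interval in $G^+$ is a nonempty, upward directed, order-hereditary subset of $G^+$; countably generated if it has a countable cofinal subset; $nD$ is the set of $z\in G^+$ with $z\le x_1+\dots+x_n$ for some $x_i\in D$. $D$ is unbounded if for an order-unit $u$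 and every state $s$ on $(G,u)$ (positive homomorphism to $\mathbb{R}$ with $s(u)=1$), $\sup_{x\in D}s(x)=\infty$. *)

theory Defs
  imports Complex_Main "HOL-Library.Extended_Nat" "HOL-Computational_Algebra.Primes"
begin

text \<open>A generalized integer is a map from primes to 0,1,...,infinity. We use functions
  nat => enat; only the values at primes are ever inspected.\<close>

type_synonym gint = "nat \<Rightarrow> enat"

definition gint_of_nat :: "nat \<Rightarrow> gint" where
  "gint_of_nat a = (\<lambda>p. if a = 0 then \<infinity> else enat (multiplicity p a))"

definition gmult :: "gint \<Rightarrow> gint \<Rightarrow> gint" where
  "gmult n m = (\<lambda>p. n p + m p)"

definition gprod :: "(nat \<Rightarrow> gint) \<Rightarrow> gint" where
  "gprod e = (\<lambda>p. SUP N. (\<Sum>k<N. e k p))"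

definition gdvd :: "gint \<Rightarrow> gint \<Rightarrow> bool" where
  "gdvd n m \<longleftrightarrow> (\<exists>n'. \<forall>p. prime p \<longrightarrow> m p = n p + n' p)"

definition gcoprime :: "gint \<Rightarrow> gint \<Rightarrow> bool" where
  "gcoprime n m \<longleftrightarrow> (\<forall>p. prime p \<longrightarrow> n p = 0 \<or> m p = 0)"

definition Zgen :: "gint \<Rightarrow> rat set" where
  "Zgen n = {of_int a / of_nat b | a b. b > 0 \<and> gdvd (gint_of_nat b) n}"

definition seq_gint :: "(nat \<Rightarrow> nat) \<Rightarrow> gint" where
  "seq_gint A = gprod (\<lambda>k. gint_of_nat (A k))"

definition subgroup_rat :: "rat set \<Rightarrow> bool" where
  "subgroup_rat G \<longleftrightarrow> 0 \<in> G \<and> (\<forall>x\<in>G. \<forall>y\<in>G. x + y \<in> G \<and> - x \<in> G)"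

definition po_group :: "rat set \<Rightarrow> rat set \<Rightarrow> bool" where
  "po_group G P \<longleftrightarrow> subgroup_rat G \<and> P \<subseteq> G \<and> 0 \<in> P \<and>
     (\<forall>x\<in>P. \<forall>y\<in>P. x + y \<in> P) \<and> (\<forall>x\<in>P. - x \<in> P \<longrightarrow> x = 0)"

definition pleq :: "rat set \<Rightarrow> rat \<Rightarrow> rat \<Rightarrow> bool" where
  "pleq P x y \<longleftrightarrow> y - x \<in> P"

definition order_unit :: "rat set \<Rightarrow> rat set \<Rightarrow> rat \<Rightarrow> bool" where
  "order_unit G P u \<longleftrightarrow> u \<in> P \<and> (\<forall>x\<in>G. \<exists>n::nat. pleq P x (of_nat n * u))"

definition simple_group :: "rat set \<Rightarrow> rat set \<Rightarrow> bool" where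
  "simple_group G P \<longleftrightarrow> G \<noteq> {0} \<and> (\<forall>u\<in>P. u \<noteq> 0 \<longrightarrow> order_unit G P u)"

definition riesz :: "rat set \<Rightarrow> rat set \<Rightarrow> bool" where
  "riesz G P \<longleftrightarrow> (\<forall>x\<in>P. \<forall>y1\<in>P. \<forall>y2\<in>P. pleq P x (y1 + y2) \<longrightarrow>
      (\<exists>x1\<in>P. \<exists>x2\<in>P. x = x1 + x2 \<and> pleq P x1 y1 \<and> pleq P x2 y2))"

text \<open>Rank one: isomorphic to a nonzero subgroup of Q. Since G is itself a subgroup
  of Q, this amounts to G being nonzero.\<close>
definition rank_one :: "rat set \<Rightarrow> bool" where
  "rank_one G \<longleftrightarrow> subgroup_rat G \<and> G \<noteq> {0}"

definition interval :: "rat set \<Rightarrow> rat set \<Rightarrow> rat set \<Rightarrow> bool" where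
  "interval G P D \<longleftrightarrow> D \<noteq> {} \<and> D \<subseteq> P \<and>
     (\<forall>x\<in>D. \<forall>y\<in>D. \<exists>z\<in>D. pleq P x z \<and> pleq P y z) \<and>
     (\<forall>x\<in>D. \<forall>y\<in>P. pleq P y x \<longrightarrow> y \<in> D)"

definition countably_generated :: "rat set \<Rightarrow> rat set \<Rightarrow> rat set \<Rightarrow> bool" where
  "countably_generated G P D \<longleftrightarrow> (\<exists>C. countable C \<and> C \<subseteq> D \<and> (\<forall>x\<in>D. \<exists>c\<in>C. pleq P x c))"

definition multiple_interval :: "rat set \<Rightarrow> rat set \<Rightarrow> nat \<Rightarrow> rat set \<Rightarrow> rat set" where
  "multiple_interval G P n D =
     {z \<in> P. \<exists>xs::nat \<Rightarrow> rat. (\<forall>i<n. xs i \<in> D) \<and> pleq P z (\<Sum>i<n. xs i)}"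

definition is_state :: "rat set \<Rightarrow> rat set \<Rightarrow> rat \<Rightarrow> (rat \<Rightarrow> real) \<Rightarrow> bool" where
  "is_state G P u s \<longleftrightarrow> (\<forall>x\<in>G. \<forall>y\<in>G. s (x + y) = s x + s y) \<and>
     (\<forall>x\<in>P. s x \<ge> 0) \<and> s u = 1"

definition unbounded_interval :: "rat set \<Rightarrow> rat set \<Rightarrow> rat set \<Rightarrow> bool" where
  "unbounded_interval G P D \<longleftrightarrow> (\<exists>u. order_unit G P u \<and>
     (\<forall>s. is_state G P u s \<longrightarrow> (\<forall>M::real. \<exists>x\<in>D. s x > M)))"

definition add_group_iso :: "(rat \<Rightarrow> rat) \<Rightarrow> rat set \<Rightarrow> rat set \<Rightarrow> bool" where
  "add_group_iso f G H \<longleftrightarrow> bij_betw f G H \<and> (\<forall>x\<in>G. \<forall>y\<in>G. f (x + y) = f x + f y)"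

end

theory Submission
  imports Defs "HOL-Number_Theory.Cong"
begin

text \<open>The ordered group is a union of stages \<open>b\<^sub>j\<^sup>-\<^sup>1 Zgen m\<close> whose cones \<open>P\<^sub>j\<close> extend the usual
  order of \<open>Zgen m\<close>. One stage refines a single equation \<open>x1 + x2 = y1 + y2\<close> in \<open>P\<^sub>j\<close>: it adjoins to the
  group a rational \<open>z\<close> of order \<open>a\<close> modulo the old group, where \<open>a\<close> is a divisor of a new term of the
  sequence, and to the cone the four entries \<open>z\<close>, \<open>x1 - z\<close>, \<open>y1 - z\<close>, \<open>z + x2 - y1\<close> of a refinement
  matrix, all of size at least some \<open>\<epsilon> > 0\<close> independent of \<open>a\<close>. These are congruent to \<open>z\<close> or \<open>- z\<close>
  modulo the old group, so a combination lying in the old group either uses equally many of both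
  kinds, and is then already in \<open>P\<^sub>j\<close>, or uses at least \<open>a\<close> of them and has size at least \<open>a * \<epsilon>\<close>.
  Taking \<open>a\<close> large therefore keeps any prescribed bounded part of the old cone unchanged.

  Whenever \<open>x2 = y1\<close>, the generator \<open>d\<close> of the interval is increased to \<open>d + z\<close>. As \<open>n * z\<close> has a
  nontrivial class for \<open>n < a\<close>, an element \<open>n * (d + z) - w\<close> can become positive only if \<open>n * d - w\<close>
  was. Hence \<open>w > n * d\<^sub>n\<close> is never dominated by \<open>n * d\<^sub>j\<close>, although \<open>d\<^sub>j\<close> tends to infinity.\<close>

section \<open>Generalized integers and the groups \<open>Zgen m\<close>\<close>

lemma gdvd_iff: "gdvd n m \<longleftrightarrow> (\<forall>p. prime p \<longrightarrow> n p \<le> m p)"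
proof
  assume "\<forall>p. prime p \<longrightarrow> n p \<le> m p"
  then have "\<forall>p. prime p \<longrightarrow> (\<exists>x. m p = n p + x)"
    by (auto simp: le_iff_add)
  then show "gdvd n m" unfolding gdvd_def by metis
qed (auto simp: gdvd_def)

lemma gdvd_of_nat_iff:
  "b > 0 \<Longrightarrow> gdvd (gint_of_nat b) m \<longleftrightarrow> (\<forall>p. prime p \<longrightarrow> enat (multiplicity p b) \<le> m p)"
  by (simp add: gdvd_iff gint_of_nat_def)

lemma ZgenE:
  assumes "x \<in> Zgen m"
  obtains a b where "x = of_int a / of_nat b" "b > 0"
    "\<And>p. prime p \<Longrightarrow> enat (multiplicity p b) \<le> m p"
  using assms unfolding Zgen_def by (blast dest: gdvd_of_nat_iff[THEN iffD1])

lemma ZgenI: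
  assumes "x = of_int a / of_nat b" "b > 0"
    "\<And>p. prime p \<Longrightarrow> enat (multiplicity p b) \<le> m p"
  shows "x \<in> Zgen m"
  using assms unfolding Zgen_def by (blast intro: gdvd_of_nat_iff[THEN iffD2])

lemma of_int_in_Zgen [simp]: "of_int k \<in> Zgen m"
  by (rule ZgenI[of _ k 1]) (auto simp: zero_enat_def[symmetric])

lemma of_nat_in_Zgen [simp]: "of_nat k \<in> Zgen m"
  using of_int_in_Zgen[of "int k" m] by simp

lemma zero_one_in_Zgen [simp]: "0 \<in> Zgen m" "1 \<in> Zgen m"
  using of_nat_in_Zgen[of 0 m] of_nat_in_Zgen[of 1 m] by simp_all

lemma uminus_in_Zgen: "x \<in> Zgen m \<Longrightarrow> - x \<in> Zgen m"
proof (erule ZgenE)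
  fix a b assume "x = of_int a / of_nat b" "b > 0"
    "\<And>p. prime p \<Longrightarrow> enat (multiplicity p b) \<le> m p"
  then show "- x \<in> Zgen m" by (intro ZgenI[of _ "- a" b]) auto
qed

lemma add_in_Zgen:
  assumes "x \<in> Zgen m" "y \<in> Zgen m"
  shows "x + y \<in> Zgen m"
proof -
  obtain a b where x: "x = of_int a / of_nat b" "b > 0"
    "\<And>p. prime p \<Longrightarrow> enat (multiplicity p b) \<le> m p" using ZgenE[OF assms(1)] by metis
  obtain c d where y: "y = of_int c / of_nat d" "d > 0"
    "\<And>p. prime p \<Longrightarrow> enat (multiplicity p d) \<le> m p" using ZgenE[OF assms(2)] by metis
  \<comment> \<open>The lcm is the right common denominator: its multiplicities are maxima and stay
    below \<open>m p\<close>, while those of \<open>b * d\<close> are sums.\<close>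
  obtain k where k: "lcm b d = b * k" by (metis dvdE dvd_lcm1)
  obtain l where l: "lcm b d = d * l" by (metis dvdE dvd_lcm2)
  have pos: "lcm b d > 0" using x y by (simp add: lcm_pos_nat)
  have kl: "k > 0" "l > 0" using pos k l by (auto intro: Nat.gr0I)
  have "x = of_int (a * int k) / of_nat (lcm b d)"
    using x(1) kl unfolding k by simp
  moreover have "y = of_int (c * int l) / of_nat (lcm b d)"
    using y(1) kl unfolding l by simp
  ultimately have "x + y = of_int (a * int k + c * int l) / of_nat (lcm b d)"
    by (simp add: add_divide_distrib)
  then show ?thesis
  proof (rule ZgenI[OF _ pos])
    fix p :: nat assume "prime p"
    then show "enat (multiplicity p (lcm b d)) \<le> m p"
      using x y by (simp add: multiplicity_lcm max_def)
  qed
qed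

lemma diff_in_Zgen: "x \<in> Zgen m \<Longrightarrow> y \<in> Zgen m \<Longrightarrow> x - y \<in> Zgen m"
  using add_in_Zgen[OF _ uminus_in_Zgen, of x m y] by simp

lemma of_nat_mult_in_Zgen: "x \<in> Zgen m \<Longrightarrow> of_nat k * x \<in> Zgen m"
  by (induction k) (auto simp: algebra_simps intro: add_in_Zgen)

section \<open>The scaled groups \<open>b^-1 * Zgen m\<close>\<close>

definition scaled_Zgen :: "gint \<Rightarrow> nat \<Rightarrow> rat set" where
  "scaled_Zgen m b = {x. of_nat b * x \<in> Zgen m}"

lemma Zgen_subset_scaled: "Zgen m \<subseteq> scaled_Zgen m b"
  by (auto simp: scaled_Zgen_def of_nat_mult_in_Zgen)

lemma scaled_Zgen_closed:
  assumes "x \<in> scaled_Zgen m b"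
  shows "- x \<in> scaled_Zgen m b" "y \<in> scaled_Zgen m b \<Longrightarrow> x + y \<in> scaled_Zgen m b"
    "y \<in> scaled_Zgen m b \<Longrightarrow> x - y \<in> scaled_Zgen m b" "of_nat k * x \<in> scaled_Zgen m b"
proof -
  have neg: "- v \<in> scaled_Zgen m b" if "v \<in> scaled_Zgen m b" for v
    using that uminus_in_Zgen by (fastforce simp: scaled_Zgen_def)
  have nat: "of_nat n * x \<in> scaled_Zgen m b" for n
    using assms of_nat_mult_in_Zgen[of "of_nat b * x" m n]
    by (simp add: scaled_Zgen_def algebra_simps)
  show "- x \<in> scaled_Zgen m b" "of_nat k * x \<in> scaled_Zgen m b"
    by (fact neg[OF assms] nat)+
  show "y \<in> scaled_Zgen m b \<Longrightarrow> x + y \<in> scaled_Zgen m b"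
    "y \<in> scaled_Zgen m b \<Longrightarrow> x - y \<in> scaled_Zgen m b"
    using assms by (auto simp: scaled_Zgen_def algebra_simps add_in_Zgen diff_in_Zgen)
qed

lemma scaled_Zgen_mono: "b dvd b' \<Longrightarrow> scaled_Zgen m b \<subseteq> scaled_Zgen m b'"
proof
  fix x assume "b dvd b'" "x \<in> scaled_Zgen m b"
  then obtain k where "b' = b * k" "of_nat b * x \<in> Zgen m"
    by (auto simp: scaled_Zgen_def elim: dvdE)
  then show "x \<in> scaled_Zgen m b'"
    using of_nat_mult_in_Zgen[of "of_nat b * x" m k] by (simp add: scaled_Zgen_def mult_ac)
qed

section \<open>Rationals of order \<open>a\<close> modulo a scaled group\<close>

text \<open>A common prime \<open>p\<close> has \<open>m p = 0\<close> because it divides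
  \<open>a\<close>, so it cannot divide \<open>q\<close>. Denominators of \<open>Zgen m\<close> are
  thus invertible modulo \<open>a\<close>.\<close>

lemma coprime_of_supports:
  fixes a q :: nat
  assumes "q > 0" "\<And>p. prime p \<Longrightarrow> enat (multiplicity p q) \<le> m p"
    "\<And>p. prime p \<Longrightarrow> p dvd a \<Longrightarrow> m p = 0"
  shows "coprime a q"
proof (rule ccontr)
  assume "\<not> coprime a q"
  then obtain p where p: "prime p" "p dvd a" "p dvd q"
    by (metis gcd_nat.bounded_iff coprime_iff_gcd_eq_1 prime_factor_nat)
  then have "multiplicity p q = 0"
    using assms(2)[OF p(1)] assms(3)[OF p(1,2)] by (simp add: zero_enat_def)
  then show False using p assms(1) by (simp add: prime_multiplicity_gt_zero_iff prime_elem_multiplicity_eq_zero_iff)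
qed

text \<open>The class of \<open>c / (b * a)\<close> modulo \<open>scaled_Zgen m b\<close> has order
  \<open>a\<close>: a multiple lying in that group gives \<open>k * c / a = r / q\<close> with
  \<open>q\<close> prime to \<open>a\<close>, and \<open>c\<close> is prime to \<open>a\<close> as
  well.\<close>

lemma dvd_of_multiple_in_scaled:
  assumes "b > 0" "a > 0" "coprime c (int a)" "\<And>p. prime p \<Longrightarrow> p dvd a \<Longrightarrow> m p = 0"
    and "of_int k * (of_int c / of_nat (b * a)) \<in> scaled_Zgen m b"
  shows "int a dvd k"
proof -
  have "of_int (k * c) / of_nat a \<in> Zgen m"
    using assms(1,5) by (simp add: scaled_Zgen_def)
  then obtain r q where rq: "of_int (k * c) / of_nat a = (of_int r / of_nat q :: rat)" "q > 0"
    "\<And>p. prime p \<Longrightarrow> enat (multiplicity p q) \<le> m p" using ZgenE by metis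
  have "of_int (k * c * int q) = (of_int (r * int a) :: rat)"
    using rq(1,2) assms(2) by (simp add: field_simps)
  then have eq: "k * c * int q = r * int a" by (simp only: of_int_eq_iff)
  have "coprime (int a) (int q)"
    using coprime_of_supports[OF rq(2,3) assms(4)] by simp
  then show ?thesis using eq assms(3)
    by (metis coprime_commute coprime_dvd_mult_left_iff dvd_triv_right)
qed

text \<open>Adjoining \<open>c / (b * a)\<close> yields all of \<open>scaled_Zgen m (b * a)\<close>:
  as \<open>c * q\<close> is invertible modulo \<open>a\<close>, some \<open>k\<close> makes
  \<open>r - c * q * k\<close> divisible by \<open>a\<close>, which removes \<open>a\<close> from
  the denominator.\<close>

lemma scaled_Zgen_extend:
  assumes "b > 0" "a > 0" "coprime c (int a)" "\<And>p. prime p \<Longrightarrow> p dvd a \<Longrightarrow> m p = 0"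
    and "x \<in> scaled_Zgen m (b * a)"
  obtains g k where "g \<in> scaled_Zgen m b" "x = g + of_nat k * (of_int c / of_nat (b * a))"
proof -
  have "of_nat (b * a) * x \<in> Zgen m" using assms(5) by (simp add: scaled_Zgen_def)
  then obtain r q where rq: "of_nat (b * a) * x = (of_int r / of_nat q :: rat)" "q > 0"
    "\<And>p. prime p \<Longrightarrow> enat (multiplicity p q) \<le> m p" using ZgenE by metis
  have "coprime (int a) (int q)"
    using coprime_of_supports[OF rq(2,3) assms(4)] by simp
  then have "coprime (c * int q) (int a)" using assms(3) by (simp add: coprime_commute)
  then obtain k0 where k0: "[c * int q * k0 = 1] (mod int a)" using cong_solve_coprime_int by blast
  \<comment> \<open>A nonnegative representative is taken because the adjoined rational will be
    positive in the new cone, where only its natural multiples are available.\<close>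
  define k where "k = nat ((k0 * r) mod int a)"
  have k: "int k = (k0 * r) mod int a" using assms(2) by (simp add: k_def)
  have "[c * int q * int k = c * int q * (k0 * r)] (mod int a)"
    unfolding k by (intro cong_mult cong_refl) simp
  also have "[c * int q * (k0 * r) = 1 * r] (mod int a)"
    using cong_mult[OF k0 cong_refl[of r]] by (simp add: mult_ac)
  finally have "[r = c * int q * int k] (mod int a)" by (simp add: cong_sym)
  then have "int a dvd r - c * int q * int k" by (simp add: cong_iff_dvd_diff)
  then obtain l where l: "r - c * int q * int k = int a * l" by (elim dvdE)
  then have l': "of_int r - of_int c * of_nat q * of_nat k = (of_nat a * of_int l :: rat)"
    by (metis of_int_diff of_int_mult of_int_of_nat_eq)
  define g where "g = x - of_nat k * (of_int c / of_nat (b * a))"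
  have "of_nat b * g = of_int l / of_nat q"
  proof -
    have "of_nat b * g = (of_nat (b * a) * x - of_nat k * of_int c) / of_nat a"
      using assms(1,2) unfolding g_def by (simp add: right_diff_distrib diff_divide_distrib)
    also have "\<dots> = (of_int r - of_int c * of_nat q * of_nat k) / (of_nat q * of_nat a)"
      using rq(2) unfolding rq(1) by (simp add: diff_divide_distrib)
    also have "\<dots> = of_int l / of_nat q"
      using assms(2) unfolding l' by simp
    finally show ?thesis .
  qed
  then have "g \<in> scaled_Zgen m b"
    unfolding scaled_Zgen_def using ZgenI[OF _ rq(2,3)] by blast
  moreover have "x = g + of_nat k * (of_int c / of_nat (b * a))" unfolding g_def by simp
  ultimately show ?thesis by (rule that)
qed

text \<open>Of two consecutive numerators one shares with \<open>a\<close> a factor of size at most \<open>sqrt a\<close>, since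
  the two factors are coprime divisors of \<open>a\<close>.\<close>
lemma fraction_with_large_denominator:
  fixes lo hi :: rat and b K :: nat
  assumes "lo < hi" "b > 0"
  obtains a0 where "\<And>a. a \<ge> a0 \<Longrightarrow> \<exists>a' c. a' dvd a \<and> a' \<ge> K \<and> a' > 0 \<and> coprime c (int a') \<and>
      lo \<le> of_int c / of_nat (b * a') \<and> of_int c / of_nat (b * a') \<le> hi"
proof -
  \<comment> \<open>This threshold makes \<open>(hi - lo) * (b * a)\<close> exceed 2, leaving room
    for two consecutive numerators over \<open>b * a\<close>.\<close>
  obtain a1 where a1: "of_nat a1 > 2 / (of_nat b * (hi - lo))" using reals_Archimedean2 by blast
  show ?thesis
  proof (rule that[of "max (max 1 a1) (K * K)"])
    fix a :: nat assume a: "max (max 1 a1) (K * K) \<le> a"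
    then have apos: "a > 0" by simp
    have "of_nat a1 \<le> (of_nat a :: rat)" using a by (simp only: of_nat_le_iff)
    then have "of_nat a > 2 / (of_nat b * (hi - lo))" using a1 by linarith
    then have big: "(hi - lo) * of_nat (b * a) > 2"
      using assms by (simp add: field_simps)
    define c where "c = \<lceil>lo * of_nat (b * a)\<rceil>"
    have c: "lo * of_nat (b * a) \<le> of_int c" "of_int (c + 1) \<le> hi * of_nat (b * a)"
      using big ceiling_correct[of "lo * of_nat (b * a)"] unfolding c_def
      by (simp_all add: left_diff_distrib)
    have "coprime (gcd c (int a)) (gcd (c + 1) (int a))"
    proof -
      have "coprime c (c + 1)" by simp
      then show ?thesis by (rule coprime_divisors[rotated 2]) auto
    qed
    then have "gcd c (int a) * gcd (c + 1) (int a) dvd int a"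
      by (intro divides_mult) auto
    then have le: "gcd c (int a) * gcd (c + 1) (int a) \<le> int a"
      using apos by (intro zdvd_imp_le) auto
    have "\<exists>e. (e = c \<or> e = c + 1) \<and> gcd e (int a) * gcd e (int a) \<le> int a"
    proof (cases "gcd c (int a) \<le> gcd (c + 1) (int a)")
      case True
      then have "gcd c (int a) * gcd c (int a) \<le> gcd c (int a) * gcd (c + 1) (int a)"
        by (intro mult_left_mono) auto
      then show ?thesis using le by force
    next
      case False
      then have "gcd (c + 1) (int a) * gcd (c + 1) (int a) \<le> gcd c (int a) * gcd (c + 1) (int a)"
        by (intro mult_right_mono) auto
      then show ?thesis using le by force
    qed
    then obtain e where e: "e = c \<or> e = c + 1" "gcd e (int a) * gcd e (int a) \<le> int a" by blast
    define g where "g = nat (gcd e (int a))"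
    have g: "int g = gcd e (int a)" by (simp add: g_def)
    have gpos: "g > 0" using apos by (simp add: g_def)
    have "int g dvd int a" "int g dvd e" by (simp_all add: g)
    then obtain a' c' where a': "a = g * a'" and c': "e = int g * c'"
      by (metis dvdE int_dvd_int_iff)
    have a'pos: "a' > 0" using apos a' by (auto intro: Nat.gr0I)
    have "int g * gcd c' (int a') = int g"
      using g unfolding a' c' by (simp add: gcd_mult_distrib_int[symmetric])
    then have cop: "coprime c' (int a')" using gpos by (simp add: coprime_iff_gcd_eq_1)
    have "int (g * g) \<le> int (g * a')" using e(2) unfolding g[symmetric] a'[symmetric] by simp
    then have "g * g \<le> g * a'" by (simp only: of_nat_le_iff)
    then have "g \<le> a'" using gpos by simp
    \<comment> \<open>Since \<open>g \<le> a'\<close> gives \<open>a \<le> a' * a'\<close>, the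
      bound \<open>K * K \<le> a\<close> passes to \<open>a'\<close>.\<close>
    have "K \<le> a'"
    proof (rule ccontr)
      assume "\<not> K \<le> a'"
      then have "a' * a' < K * K" by (simp add: mult_strict_mono)
      moreover have "a \<le> a' * a'" using \<open>g \<le> a'\<close> a' by simp
      ultimately show False using a by simp
    qed
    have "(of_int e :: rat) / of_nat (b * a) = of_int c' / of_nat (b * a')"
      using gpos unfolding a' c' by simp
    moreover have "lo * of_nat (b * a) \<le> of_int e" "of_int e \<le> hi * of_nat (b * a)"
      using c e(1) by auto
    then have "lo \<le> of_int e / of_nat (b * a)" "of_int e / of_nat (b * a) \<le> hi"
      using apos assms(2) by (simp_all add: field_simps)
    ultimately show "\<exists>a' c. a' dvd a \<and> a' \<ge> K \<and> a' > 0 \<and> coprime c (int a') \<and>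
      lo \<le> of_int c / of_nat (b * a') \<and> of_int c / of_nat (b * a') \<le> hi"
      using a' a'pos cop \<open>K \<le> a'\<close> by (intro exI[of _ a'] exI[of _ c']) auto
  qed
qed

section \<open>Adjoining a refinement matrix to a cone\<close>

text \<open>The matrix has row sums \<open>x1\<close>, \<open>x2\<close> and column sums
  \<open>y1\<close>, \<open>x1 + x2 - y1\<close>, so \<open>z\<close> determines the other three
  entries.\<close>

definition refine_cone :: "rat set \<Rightarrow> rat \<Rightarrow> rat \<Rightarrow> rat \<Rightarrow> rat \<Rightarrow> rat set" where
  "refine_cone P x1 x2 y1 z = {p + of_nat \<alpha> * z + of_nat \<beta> * (x1 - z) + of_nat \<gamma> * (y1 - z)
      + of_nat \<delta> * (z + x2 - y1) | p \<alpha> \<beta> \<gamma> \<delta>. p \<in> P}"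

lemma refine_coneI:
  "p \<in> P \<Longrightarrow> w = p + of_nat \<alpha> * z + of_nat \<beta> * (x1 - z) + of_nat \<gamma> * (y1 - z)
      + of_nat \<delta> * (z + x2 - y1) \<Longrightarrow> w \<in> refine_cone P x1 x2 y1 z"
  unfolding refine_cone_def by blast

lemma refine_coneE:
  assumes "w \<in> refine_cone P x1 x2 y1 z"
  obtains p \<alpha> \<beta> \<gamma> \<delta> where "p \<in> P"
    "w = p + of_nat \<alpha> * z + of_nat \<beta> * (x1 - z) + of_nat \<gamma> * (y1 - z) + of_nat \<delta> * (z + x2 - y1)"
  using assms unfolding refine_cone_def by blast

lemma refine_cone_add:
  assumes "\<And>p q. p \<in> P \<Longrightarrow> q \<in> P \<Longrightarrow> p + q \<in> P"
    "v \<in> refine_cone P x1 x2 y1 z" "w \<in> refine_cone P x1 x2 y1 z"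
  shows "v + w \<in> refine_cone P x1 x2 y1 z"
proof -
  obtain p \<alpha> \<beta> \<gamma> \<delta> where v: "p \<in> P"
    "v = p + of_nat \<alpha> * z + of_nat \<beta> * (x1 - z) + of_nat \<gamma> * (y1 - z) + of_nat \<delta> * (z + x2 - y1)"
    using assms(2) by (rule refine_coneE)
  obtain q \<alpha>' \<beta>' \<gamma>' \<delta>' where w: "q \<in> P"
    "w = q + of_nat \<alpha>' * z + of_nat \<beta>' * (x1 - z) + of_nat \<gamma>' * (y1 - z) + of_nat \<delta>' * (z + x2 - y1)"
    using assms(3) by (rule refine_coneE)
  show ?thesis
    by (rule refine_coneI[OF assms(1)[OF v(1) w(1)],
          of _ "\<alpha> + \<alpha>'" _ "\<beta> + \<beta>'" _ "\<gamma> + \<gamma>'" _ "\<delta> + \<delta>'"])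
      (simp add: v(2) w(2) algebra_simps)
qed

text \<open>A generator congruent to \<open>z\<close> plus one congruent to \<open>- z\<close> is one of the four elements being
  refined, so all generators of the second kind can be absorbed into \<open>P\<close>.\<close>
lemma cancel_generators:
  fixes P :: "rat set" and x1 x2 y1 z :: rat
  defines "w \<equiv> \<lambda>p \<alpha> \<beta> \<gamma> \<delta>. p + of_nat \<alpha> * z + of_nat \<beta> * (x1 - z) + of_nat \<gamma> * (y1 - z)
    + of_nat \<delta> * (z + x2 - y1)"
  assumes "\<And>p q. p \<in> P \<Longrightarrow> q \<in> P \<Longrightarrow> p + q \<in> P"
    and "x1 \<in> P" "x2 \<in> P" "y1 \<in> P" "x1 + x2 - y1 \<in> P"
    and "p \<in> P" "\<alpha> + \<delta> = \<beta> + \<gamma> + n"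
  shows "\<exists>p'\<in>P. \<exists>\<alpha>' \<delta>'. \<alpha>' + \<delta>' = n \<and> w p \<alpha> \<beta> \<gamma> \<delta> = w p' \<alpha>' 0 0 \<delta>'"
  using assms(7,8)
proof (induction "\<beta> + \<gamma>" arbitrary: p \<alpha> \<beta> \<gamma> \<delta>)
  case 0
  then have "\<beta> = 0" "\<gamma> = 0" "\<alpha> + \<delta> = n" by simp_all
  then show ?case using 0(2) by blast
next
  case (Suc k)
  \<comment> \<open>One generator of the second kind is paired with one of the first, which exists
    as \<open>\<alpha> + \<delta> \<ge> \<beta> + \<gamma>\<close>. The pairs counted by \<alpha>
    and \<beta>, \<delta> and \<beta>, \<alpha> and \<gamma>, \<delta> and \<gamma> add up to
    \<open>x1\<close>, \<open>x1 + x2 - y1\<close>, \<open>y1\<close>, \<open>x2\<close>.\<close>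
  have "\<exists>q\<in>P. \<exists>\<alpha>' \<beta>' \<gamma>' \<delta>'. k = \<beta>' + \<gamma>' \<and> \<alpha>' + \<delta>' = \<beta>' + \<gamma>' + n \<and> w p \<alpha> \<beta> \<gamma> \<delta> = w q \<alpha>' \<beta>' \<gamma>' \<delta>'"
  proof (cases \<beta>)
    case b: (Suc \<beta>')
    show ?thesis
    proof (cases \<alpha>)
      case (Suc \<alpha>')
      have "w p \<alpha> \<beta> \<gamma> \<delta> = w (p + x1) \<alpha>' \<beta>' \<gamma> \<delta>" by (simp add: w_def b Suc algebra_simps)
      moreover have "k = \<beta>' + \<gamma>" "\<alpha>' + \<delta> = \<beta>' + \<gamma> + n" using b Suc Suc.hyps(2) Suc.prems(2) by simp_all
      ultimately show ?thesis using assms(2)[OF Suc.prems(1) assms(3)] by blast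
    next
      case 0
      then obtain \<delta>' where d: "\<delta> = Suc \<delta>'" using b Suc.prems(2) by (cases \<delta>) auto
      have "w p \<alpha> \<beta> \<gamma> \<delta> = w (p + (x1 + x2 - y1)) 0 \<beta>' \<gamma> \<delta>'" by (simp add: w_def b 0 d algebra_simps)
      moreover have "k = \<beta>' + \<gamma>" "0 + \<delta>' = \<beta>' + \<gamma> + n" using b 0 d Suc.hyps(2) Suc.prems(2) by simp_all
      ultimately show ?thesis using assms(2)[OF Suc.prems(1) assms(6)] by blast
    qed
  next
    case b: 0
    then obtain \<gamma>' where g: "\<gamma> = Suc \<gamma>'" using Suc.hyps(2) by (cases \<gamma>) auto
    show ?thesis
    proof (cases \<alpha>)
      case (Suc \<alpha>')
      have "w p \<alpha> \<beta> \<gamma> \<delta> = w (p + y1) \<alpha>' 0 \<gamma>' \<delta>" by (simp add: w_def b g Suc algebra_simps)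
      moreover have "k = 0 + \<gamma>'" "\<alpha>' + \<delta> = 0 + \<gamma>' + n" using b g Suc Suc.hyps(2) Suc.prems(2) by simp_all
      ultimately show ?thesis using assms(2)[OF Suc.prems(1) assms(5)] by blast
    next
      case 0
      then obtain \<delta>' where d: "\<delta> = Suc \<delta>'" using g Suc.prems(2) by (cases \<delta>) auto
      have "w p \<alpha> \<beta> \<gamma> \<delta> = w (p + x2) 0 0 \<gamma>' \<delta>'" by (simp add: w_def b g 0 d algebra_simps)
      moreover have "k = 0 + \<gamma>'" "0 + \<delta>' = 0 + \<gamma>' + n" using b g 0 d Suc.hyps(2) Suc.prems(2) by simp_all
      ultimately show ?thesis using assms(2)[OF Suc.prems(1) assms(4)] by blast
    qed
  qed
  then obtain q \<alpha>' \<beta>' \<gamma>' \<delta>' where q: "q \<in> P" "k = \<beta>' + \<gamma>'" "\<alpha>' + \<delta>' = \<beta>' + \<gamma>' + n"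
    and eq: "w p \<alpha> \<beta> \<gamma> \<delta> = w q \<alpha>' \<beta>' \<gamma>' \<delta>'"
    by blast
  show ?case using Suc.hyps(1)[OF q(2,1,3)] unfolding eq .
qed

text \<open>The summand \<open>n * z\<close> accounts for the growth of \<open>d\<close>. If
  \<open>x2 = y1\<close>, the generator \<open>z + x2 - y1\<close> is \<open>z\<close> itself, so
  the \<open>n\<close> generators left after cancellation add up to exactly \<open>n * z\<close> and
  can be subtracted.\<close>

lemma small_element_of_refine_cone:
  fixes \<epsilon> :: rat
  assumes G: "\<And>u v. u \<in> G \<Longrightarrow> v \<in> G \<Longrightarrow> u + v \<in> G" "\<And>u. u \<in> G \<Longrightarrow> - u \<in> G"
      "\<And>u k. u \<in> G \<Longrightarrow> of_nat k * u \<in> G"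
    and P: "P \<subseteq> G" "\<And>p. p \<in> P \<Longrightarrow> 0 \<le> p" "\<And>p q. p \<in> P \<Longrightarrow> q \<in> P \<Longrightarrow> p + q \<in> P"
    and xy: "x1 \<in> P" "x2 \<in> P" "y1 \<in> P" "x1 + x2 - y1 \<in> P"
    and a: "\<And>k. of_int k * z \<in> G \<Longrightarrow> int a dvd k"
    and \<epsilon>: "0 \<le> \<epsilon>" "\<epsilon> \<le> z" "\<epsilon> \<le> x1 - z" "\<epsilon> \<le> y1 - z" "\<epsilon> \<le> z + x2 - y1"
    and n: "n = 0 \<or> x2 = y1"
    and g: "g \<in> G" "g + of_nat n * z \<in> refine_cone P x1 x2 y1 z"
      "g + of_nat n * z < (of_nat a - of_nat n) * \<epsilon>"
  shows "g \<in> P"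
proof -
  obtain p \<alpha> \<beta> \<gamma> \<delta> where p: "p \<in> P" and
    eq: "g + of_nat n * z = p + of_nat \<alpha> * z + of_nat \<beta> * (x1 - z) + of_nat \<gamma> * (y1 - z)
      + of_nat \<delta> * (z + x2 - y1)"
    using g(2) by (rule refine_coneE)
  \<comment> \<open>Modulo \<open>G\<close> every generator is \<open>z\<close> or
    \<open>- z\<close>, so \<open>k\<close> is the net number of copies of \<open>z\<close> beyond
    the \<open>n\<close> on the left.\<close>
  define k where "k = int \<alpha> + int \<delta> - int \<beta> - int \<gamma> - int n"
  have "of_int k * z = g + - (p + of_nat \<beta> * x1 + of_nat \<gamma> * y1 + of_nat \<delta> * (x2 + - y1))"
    using eq unfolding k_def by (simp add: algebra_simps)
  also have "\<dots> \<in> G"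
    using g(1) p xy P(1) by (intro G) auto
  finally have dvd: "int a dvd k" by (rule a)
  have size: "of_nat (\<alpha> + \<beta> + \<gamma> + \<delta>) * \<epsilon> \<le> g + of_nat n * z"
  proof -
    have "of_nat \<alpha> * \<epsilon> \<le> of_nat \<alpha> * z" "of_nat \<beta> * \<epsilon> \<le> of_nat \<beta> * (x1 - z)"
      "of_nat \<gamma> * \<epsilon> \<le> of_nat \<gamma> * (y1 - z)" "of_nat \<delta> * \<epsilon> \<le> of_nat \<delta> * (z + x2 - y1)"
      using \<epsilon> by (auto intro!: mult_left_mono)
    then show ?thesis using P(2)[OF p] unfolding eq by (simp add: distrib_right)
  qed
  \<comment> \<open>If \<open>k\<close> is a nonzero multiple of \<open>a\<close>, at least
    \<open>a - n\<close> generators occur, each of size at least \<open>\<epsilon>\<close>.\<close>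
  have "k = 0"
  proof (rule ccontr)
    assume "k \<noteq> 0"
    then have "int a \<le> \<bar>k\<bar>" using dvd dvd_imp_le_int[of k "int a"] by simp
    then have "a \<le> \<alpha> + \<beta> + \<gamma> + \<delta> + n" unfolding k_def by linarith
    then have "(of_nat a :: rat) \<le> of_nat (\<alpha> + \<beta> + \<gamma> + \<delta> + n)" by (simp only: of_nat_le_iff)
    then have "(of_nat a - of_nat n) * \<epsilon> \<le> of_nat (\<alpha> + \<beta> + \<gamma> + \<delta>) * \<epsilon>"
      using \<epsilon>(1) by (intro mult_right_mono) auto
    then show False using size g(3) by linarith
  qed
  then have "\<alpha> + \<delta> = \<beta> + \<gamma> + n" unfolding k_def by linarith
  then obtain p' \<alpha>' \<delta>' where p': "p' \<in> P" and n': "\<alpha>' + \<delta>' = n"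
    and eq': "g + of_nat n * z = p' + of_nat \<alpha>' * z + of_nat \<delta>' * (z + x2 - y1)"
    using cancel_generators[OF P(3) xy p, of \<alpha> \<delta> \<beta> \<gamma> n z] unfolding eq by auto
  have "g = p'"
    using n
  proof
    assume "n = 0"
    then show "g = p'" using eq' n' by simp
  next
    assume "x2 = y1"
    then show "g = p'" using eq' n'[symmetric] by (simp add: algebra_simps)
  qed
  then show ?thesis using p' by simp
qed

section \<open>One step of the construction\<close>

text \<open>All terms of \<open>A\<close> consumed so far have index below \<open>t\<close>, so a
  new factor of \<open>b\<close> can be charged to a fresh term. The clause with \<open>h\<close>
  makes \<open>Zgen m\<close> cofinal, which later yields order-units.\<close>

definition cone_stage :: "gint \<Rightarrow> (nat \<Rightarrow> nat) \<Rightarrow> nat \<Rightarrow> nat \<Rightarrow> rat set \<Rightarrow> rat \<Rightarrow> bool" where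
  "cone_stage m A b t P d \<longleftrightarrow> b > 0 \<and>
     (\<forall>p. prime p \<longrightarrow> enat (multiplicity p b) \<le> (\<Sum>k<t. gint_of_nat (A k) p)) \<and>
     P \<subseteq> scaled_Zgen m b \<and> (\<forall>p\<in>P. 0 \<le> p) \<and> (\<forall>p\<in>P. \<forall>q\<in>P. p + q \<in> P) \<and>
     (\<forall>x\<in>Zgen m. 0 \<le> x \<longrightarrow> x \<in> P) \<and> (\<forall>x\<in>scaled_Zgen m b. \<exists>h\<in>Zgen m. x + h \<in> P) \<and> d \<in> P"

lemma partial_sum_le_seq_gint: "(\<Sum>k<t. gint_of_nat (A k) p) \<le> seq_gint A p"
  unfolding seq_gint_def gprod_def by (rule SUP_upper) simp

lemma cone_stage_initial: "cone_stage m A 1 0 {x \<in> Zgen m. 0 \<le> x} 0"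
proof -
  have "\<exists>h\<in>Zgen m. x + h \<in> Zgen m \<and> 0 \<le> x + h" if "x \<in> Zgen m" for x
    using that by (intro bexI[of _ "- x"]) (auto intro: uminus_in_Zgen)
  then show ?thesis
    by (auto simp: cone_stage_def scaled_Zgen_def zero_enat_def add_in_Zgen)
qed

text \<open>The last clause protects the interval: for \<open>g = n * d - w\<close> with
  \<open>w \<ge> 0\<close> it says that \<open>n * d' - w\<close> is positive only if
  \<open>n * d - w\<close> was. The bound \<open>N\<close> is there because \<open>a\<close> has to
  exceed every \<open>n\<close> concerned.\<close>

lemma cone_stage_extend:
  assumes A: "strict_mono A" "gcoprime m (seq_gint A)"
    and st: "cone_stage m A b t P d"
    and xy: "x1 \<in> P" "x2 \<in> P" "y1 \<in> P" "x1 + x2 - y1 \<in> P"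
    and pos: "0 < x1" "0 < x2" "0 < y1" "0 < x1 + x2 - y1"
  obtains b' t' P' d' z where "cone_stage m A b' t' P' d'" "b dvd b'" "P \<subseteq> P'" "d' - d \<in> P'"
    "z \<in> P'" "x1 - z \<in> P'" "y1 - z \<in> P'" "z + x2 - y1 \<in> P'"
    "x2 = y1 \<Longrightarrow> d + min x1 y1 / 3 \<le> d'"
    "\<And>g n. g \<in> scaled_Zgen m b \<Longrightarrow> n \<le> N \<Longrightarrow> g \<le> of_nat n * d \<Longrightarrow>
       g + of_nat n * (d' - d) \<in> P' \<Longrightarrow> g \<in> P"
proof -
  have b: "b > 0" and bA: "\<And>p. prime p \<Longrightarrow> enat (multiplicity p b) \<le> (\<Sum>k<t. gint_of_nat (A k) p)"
    and PG: "P \<subseteq> scaled_Zgen m b" and P0: "\<And>p. p \<in> P \<Longrightarrow> 0 \<le> p"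
    and Padd: "\<And>p q. p \<in> P \<Longrightarrow> q \<in> P \<Longrightarrow> p + q \<in> P"
    and PZ: "\<And>x. x \<in> Zgen m \<Longrightarrow> 0 \<le> x \<Longrightarrow> x \<in> P"
    and Pdir: "\<And>x. x \<in> scaled_Zgen m b \<Longrightarrow> \<exists>h\<in>Zgen m. x + h \<in> P" and d: "d \<in> P"
    using st unfolding cone_stage_def by blast+
  \<comment> \<open>All four entries are positive exactly for \<open>lo < z < hi\<close>, and the
    positivity hypotheses give \<open>lo < hi\<close>. Choosing \<open>z\<close> in the middle third
    keeps each entry at least \<open>\<epsilon>\<close>.\<close>
  define lo where "lo = max 0 (y1 - x2)"
  define hi where "hi = min x1 y1"
  define \<epsilon> where "\<epsilon> = (hi - lo) / 3"
  have \<epsilon>: "\<epsilon> > 0" using pos by (auto simp: \<epsilon>_def lo_def hi_def)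
  \<comment> \<open>Equivalently \<open>N * (d + x1) < (K - N) * \<epsilon>\<close>, the smallness
    condition for all \<open>a \<ge> K\<close>.\<close>
  obtain K where K: "of_nat N + of_nat N * (d + x1) / \<epsilon> < (of_nat K :: rat)"
    using reals_Archimedean2 by blast
  have "lo + \<epsilon> < hi - \<epsilon>" using \<epsilon> by (simp add: \<epsilon>_def field_simps)
  then obtain a0 where a0: "\<And>a. a \<ge> a0 \<Longrightarrow> \<exists>a' c. a' dvd a \<and> a' \<ge> K \<and> a' > 0 \<and> coprime c (int a') \<and>
      lo + \<epsilon> \<le> of_int c / of_nat (b * a') \<and> of_int c / of_nat (b * a') \<le> hi - \<epsilon>"
    using fraction_with_large_denominator[OF _ b, of "lo + \<epsilon>" "hi - \<epsilon>" K] by blast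
  \<comment> \<open>\<open>i \<ge> t\<close> selects an unconsumed term, \<open>i \<ge> a0\<close>
    makes it large because \<open>A i \<ge> i\<close>, and \<open>i \<ge> 1\<close> excludes a
    possible \<open>A 0 = 0\<close>.\<close>
  define i where "i = max (max 1 t) a0"
  have i: "i \<ge> 1" "i \<ge> t" "i \<ge> a0" by (simp_all add: i_def)
  have "A i \<ge> i" using A(1) by (rule strict_mono_imp_increasing)
  then have Ai: "A i \<ge> a0" "A i > 0" using i by linarith+
  obtain a c where a: "a dvd A i" "a \<ge> K" "a > 0" "coprime c (int a)"
    and c: "lo + \<epsilon> \<le> of_int c / of_nat (b * a)" "of_int c / of_nat (b * a) \<le> hi - \<epsilon>"
    using a0[OF Ai(1)] by blast
  define z :: rat where "z = of_int c / of_nat (b * a)"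
  have z: "\<epsilon> \<le> z" "\<epsilon> \<le> x1 - z" "\<epsilon> \<le> y1 - z" "\<epsilon> \<le> z + x2 - y1"
    using c unfolding z_def[symmetric] lo_def hi_def by auto
  have multA: "multiplicity p a \<le> multiplicity p (A i)" for p
    using a(1) Ai(2) by (intro dvd_imp_multiplicity_le) auto
  have Ap: "gint_of_nat (A i) p = enat (multiplicity p (A i))" for p
    using Ai(2) by (simp add: gint_of_nat_def)
  \<comment> \<open>Coprimality enters here: primes of \<open>a\<close> divide \<open>A i\<close>,
    hence lie outside the support of \<open>m\<close>, and \<open>z\<close> gets order
    \<open>a\<close>.\<close>
  have mp: "m p = 0" if p: "prime p" "p dvd a" for p
  proof -
    have "multiplicity p a > 0" using p a(3) by (simp add: prime_multiplicity_gt_zero_iff)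
    then have "0 < gint_of_nat (A i) p" using multA[of p] by (simp add: Ap zero_enat_def)
    also have "\<dots> \<le> (\<Sum>k<Suc i. gint_of_nat (A k) p)" by simp
    also have "\<dots> \<le> seq_gint A p" by (rule partial_sum_le_seq_gint)
    finally have "seq_gint A p \<noteq> 0" by simp
    then show ?thesis using A(2) p(1) unfolding gcoprime_def by blast
  qed
  define b' where "b' = b * a"
  define P' where "P' = refine_cone P x1 x2 y1 z"
  \<comment> \<open>\<open>d\<close> grows only when both generators of the first kind equal
    \<open>z\<close>, so that leftover generators cancel against the increment.\<close>
  define d' where "d' = (if x2 = y1 then d + z else d)"
  have "0 \<in> P" by (rule PZ) auto
  have gens: "z \<in> P'" "x1 - z \<in> P'" "y1 - z \<in> P'" "z + x2 - y1 \<in> P'"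
    unfolding P'_def
    by (rule refine_coneI[OF \<open>0 \<in> P\<close>, of _ 1 _ 0 _ 0 _ 0], simp)
      (rule refine_coneI[OF \<open>0 \<in> P\<close>, of _ 0 _ 1 _ 0 _ 0], simp,
       rule refine_coneI[OF \<open>0 \<in> P\<close>, of _ 0 _ 0 _ 1 _ 0], simp,
       rule refine_coneI[OF \<open>0 \<in> P\<close>, of _ 0 _ 0 _ 0 _ 1], simp)
  have PP': "P \<subseteq> P'"
    unfolding P'_def by (rule subsetI, rule refine_coneI[of _ _ _ 0 _ 0 _ 0 _ 0]) auto
  have P'add: "p + q \<in> P'" if "p \<in> P'" "q \<in> P'" for p q
    using refine_cone_add[OF Padd] that unfolding P'_def by blast
  have GG': "scaled_Zgen m b \<subseteq> scaled_Zgen m b'"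
    unfolding b'_def by (rule scaled_Zgen_mono) simp
  have zG': "z \<in> scaled_Zgen m b'"
    using b a(3) unfolding z_def b'_def scaled_Zgen_def by simp
  have P'G': "P' \<subseteq> scaled_Zgen m b'"
  proof
    fix w assume "w \<in> P'"
    then obtain p \<alpha> \<beta> \<gamma> \<delta> where w: "p \<in> P" "w = p + of_nat \<alpha> * z + of_nat \<beta> * (x1 - z)
      + of_nat \<gamma> * (y1 - z) + of_nat \<delta> * (z + x2 - y1)"
      unfolding P'_def by (rule refine_coneE)
    have "p \<in> scaled_Zgen m b'" "x1 \<in> scaled_Zgen m b'" "x2 \<in> scaled_Zgen m b'" "y1 \<in> scaled_Zgen m b'"
      using w(1) xy PG GG' by blast+
    then show "w \<in> scaled_Zgen m b'"
      unfolding w(2) using zG' by (intro scaled_Zgen_closed)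
  qed
  have P'0: "0 \<le> w" if "w \<in> P'" for w
    using that[unfolded P'_def]
  proof (rule refine_coneE)
    fix p \<alpha> \<beta> \<gamma> \<delta> assume "p \<in> P" "w = p + of_nat \<alpha> * z + of_nat \<beta> * (x1 - z)
      + of_nat \<gamma> * (y1 - z) + of_nat \<delta> * (z + x2 - y1)"
    then show "0 \<le> w" using z \<epsilon> P0 by (auto intro!: add_nonneg_nonneg mult_nonneg_nonneg)
  qed
  have P'dir: "\<exists>h\<in>Zgen m. x + h \<in> P'" if x: "x \<in> scaled_Zgen m b'" for x
  proof -
    obtain g k where g: "g \<in> scaled_Zgen m b" "x = g + of_nat k * z"
      using scaled_Zgen_extend[OF b a(3,4) mp x[unfolded b'_def]] unfolding z_def by blast
    obtain h where h: "h \<in> Zgen m" "g + h \<in> P" using Pdir[OF g(1)] by blast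
    have "x + h \<in> P'"
      unfolding P'_def by (rule refine_coneI[OF h(2), of _ k _ 0 _ 0 _ 0]) (simp add: g(2))
    then show ?thesis using h(1) by blast
  qed
  have d'd: "d' - d \<in> P'" using gens(1) \<open>0 \<in> P\<close> PP' by (auto simp: d'_def)
  have b'A: "enat (multiplicity p b') \<le> (\<Sum>k<Suc i. gint_of_nat (A k) p)" if p: "prime p" for p
  proof -
    have "enat (multiplicity p b') = enat (multiplicity p b) + enat (multiplicity p a)"
      using b a(3) p unfolding b'_def by (subst prime_elem_multiplicity_mult_distrib) auto
    also have "\<dots> \<le> (\<Sum>k<i. gint_of_nat (A k) p) + gint_of_nat (A i) p"
    proof (rule add_mono)
      have "(\<Sum>k<t. gint_of_nat (A k) p) \<le> (\<Sum>k<i. gint_of_nat (A k) p)"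
        using i(2) by (intro sum_mono2) auto
      then show "enat (multiplicity p b) \<le> (\<Sum>k<i. gint_of_nat (A k) p)"
        using bA[OF p] by (rule order_trans[rotated])
      show "enat (multiplicity p a) \<le> gint_of_nat (A i) p" using multA by (simp add: Ap)
    qed
    finally show ?thesis by simp
  qed
  have "d' \<in> P'" using P'add[OF d'd, of d] d PP' by auto
  then have st': "cone_stage m A b' (Suc i) P' d'"
    unfolding cone_stage_def using b a(3) b'A P'G' P'0 P'add PZ PP' P'dir
    by (auto simp: b'_def)
  have gap: "g \<in> P" if g: "g \<in> scaled_Zgen m b" "n \<le> N" "g \<le> of_nat n * d"
    "g + of_nat n * (d' - d) \<in> P'" for g n
  proof -
    \<comment> \<open>The number of copies of \<open>z\<close> in
      \<open>n * (d' - d)\<close>.\<close>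
    define n' where "n' = (if x2 = y1 then n else 0)"
    have n': "n' \<le> N" "n' = 0 \<or> x2 = y1" using g(2) by (auto simp: n'_def)
    have mem: "g + of_nat n' * z \<in> refine_cone P x1 x2 y1 z"
      using g(4) by (auto simp: n'_def d'_def P'_def)
    have NK: "of_nat N * (d + x1) < (of_nat K - of_nat N) * \<epsilon>"
      using K \<epsilon> by (simp add: field_simps)
    have "of_nat n * d \<le> of_nat N * d" using g(2) P0[OF d] by (intro mult_right_mono) auto
    moreover have "of_nat n' * z \<le> of_nat N * x1"
      using n'(1) z \<epsilon> by (intro mult_mono) auto
    ultimately have "g + of_nat n' * z \<le> of_nat N * (d + x1)"
      using g(3) by (simp add: distrib_left)
    also note NK
    also have "(of_nat K - of_nat N) * \<epsilon> \<le> (of_nat a - of_nat n') * \<epsilon>"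
      using a(2) n'(1) \<epsilon> by (intro mult_right_mono diff_mono) auto
    finally have small: "g + of_nat n' * z < (of_nat a - of_nat n') * \<epsilon>" .
    have div: "int a dvd k" if "of_int k * z \<in> scaled_Zgen m b" for k
      by (rule dvd_of_multiple_in_scaled[where m = m, OF b a(3,4) mp that[unfolded z_def]])
    show ?thesis
      by (rule small_element_of_refine_cone[where G = "scaled_Zgen m b" and n = n' and \<epsilon> = \<epsilon>
            and a = a and z = z, OF scaled_Zgen_closed(2) scaled_Zgen_closed(1)
            scaled_Zgen_closed(4) PG P0 Padd xy div _ z n'(2) g(1) mem small])
        (use \<epsilon> in auto)
  qed
  have "d + min x1 y1 / 3 \<le> d'" if "x2 = y1"
  proof -
    have "lo = 0" using that by (simp add: lo_def)
    then have "z \<ge> min x1 y1 / 3" using z(1) by (simp add: \<epsilon>_def hi_def)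
    then show ?thesis using that by (simp add: d'_def)
  qed
  then show ?thesis
    using that[OF st' _ PP' d'd gens _ gap] by (simp add: b'_def)
qed

section \<open>The limit group, its cone and its interval\<close>

text \<open>A refinement may appear at any stage \<open>i\<close>. A given \<open>n\<close> is
  covered by \<open>gap\<close> only from stage \<open>n\<close> on, which suffices because the
  choice of an element outside \<open>n * D\<close> can wait until then.\<close>

locale cone_tower =
  fixes m :: gint and b :: "nat \<Rightarrow> nat" and P :: "nat \<Rightarrow> rat set" and d :: "nat \<Rightarrow> rat"
  assumes b_pos: "b j > 0"
    and b_dvd_Suc: "b j dvd b (Suc j)"
    and cone_subset: "P j \<subseteq> scaled_Zgen m (b j)"
    and cone_nonneg: "x \<in> P j \<Longrightarrow> 0 \<le> x"
    and cone_add: "x \<in> P j \<Longrightarrow> y \<in> P j \<Longrightarrow> x + y \<in> P j"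
    and Zgen_nonneg_in_cone: "x \<in> Zgen m \<Longrightarrow> 0 \<le> x \<Longrightarrow> x \<in> P j"
    and cone_cofinal: "x \<in> scaled_Zgen m (b j) \<Longrightarrow> \<exists>h\<in>Zgen m. x + h \<in> P j"
    and d_in_cone: "d j \<in> P j"
    and cone_Suc: "P j \<subseteq> P (Suc j)"
    and d_Suc: "d (Suc j) - d j \<in> P (Suc j)"
    and refinement: "\<lbrakk>x1 \<in> P j; x2 \<in> P j; y1 \<in> P j; x1 + x2 - y1 \<in> P j;
        0 < x1; 0 < x2; 0 < y1; 0 < x1 + x2 - y1\<rbrakk>
      \<Longrightarrow> \<exists>i. \<exists>z\<in>P i. x1 - z \<in> P i \<and> y1 - z \<in> P i \<and> z + x2 - y1 \<in> P i"
    and d_unbounded: "\<exists>j. of_nat k < d j"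
    and gap: "\<lbrakk>g \<in> scaled_Zgen m (b j); n \<le> j; g \<le> of_nat n * d j;
        g + of_nat n * (d (Suc j) - d j) \<in> P (Suc j)\<rbrakk> \<Longrightarrow> g \<in> P j"
begin

definition G :: "rat set" where "G = (\<Union>j. scaled_Zgen m (b j))"

definition C :: "rat set" where "C = (\<Union>j. P j)"

definition D :: "rat set" where "D = {x \<in> C. \<exists>j. d j - x \<in> C}"

lemma scaled_Zgen_le: "i \<le> j \<Longrightarrow> scaled_Zgen m (b i) \<subseteq> scaled_Zgen m (b j)"
  by (rule lift_Suc_mono_le[of "\<lambda>j. scaled_Zgen m (b j)"]) (intro scaled_Zgen_mono b_dvd_Suc)

lemma cone_le: "i \<le> j \<Longrightarrow> P i \<subseteq> P j"
  by (rule lift_Suc_mono_le[of P]) (rule cone_Suc)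

lemma b_dvd: "i \<le> j \<Longrightarrow> b i dvd b j"
  by (induction rule: dec_induct) (auto intro: dvd_trans b_dvd_Suc)

lemma zero_in_cone: "0 \<in> P j"
  by (rule Zgen_nonneg_in_cone) auto

lemma d_le: "i \<le> j \<Longrightarrow> d j - d i \<in> P j"
proof (induction rule: dec_induct)
  case base
  then show ?case by (simp add: zero_in_cone)
next
  case (step n)
  then have "d n - d i \<in> P (Suc n)" using cone_Suc by blast
  from cone_add[OF this d_Suc] show ?case by simp
qed

lemma C_common: "x \<in> C \<Longrightarrow> y \<in> C \<Longrightarrow> \<exists>j. x \<in> P j \<and> y \<in> P j"
proof -
  assume "x \<in> C" "y \<in> C"
  then obtain i j where "x \<in> P i" "y \<in> P j" unfolding C_def by blast
  then show ?thesis
    using cone_le[of i "max i j"] cone_le[of j "max i j"] by (intro exI[of _ "max i j"]) auto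
qed

lemma G_common: "x \<in> G \<Longrightarrow> y \<in> G \<Longrightarrow> \<exists>j. x \<in> scaled_Zgen m (b j) \<and> y \<in> scaled_Zgen m (b j)"
proof -
  assume "x \<in> G" "y \<in> G"
  then obtain i j where "x \<in> scaled_Zgen m (b i)" "y \<in> scaled_Zgen m (b j)"
    unfolding G_def by blast
  then show ?thesis
    using scaled_Zgen_le[of i "max i j"] scaled_Zgen_le[of j "max i j"]
    by (intro exI[of _ "max i j"]) auto
qed

lemma C_add: "x \<in> C \<Longrightarrow> y \<in> C \<Longrightarrow> x + y \<in> C"
  using C_common[of x y] cone_add by (auto simp: C_def)

lemma C_nonneg: "x \<in> C \<Longrightarrow> 0 \<le> x"
  using cone_nonneg by (auto simp: C_def)

lemma zero_in_C: "0 \<in> C"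
  using zero_in_cone by (auto simp: C_def)

lemma d_in_C: "d j \<in> C"
  using d_in_cone by (auto simp: C_def)

lemma C_subset_G: "C \<subseteq> G"
  using cone_subset by (auto simp: C_def G_def)

lemma Zgen_nonneg_in_C: "x \<in> Zgen m \<Longrightarrow> 0 \<le> x \<Longrightarrow> x \<in> C"
  using Zgen_nonneg_in_cone by (auto simp: C_def)

lemma subgroup_rat_G: "subgroup_rat G"
  unfolding subgroup_rat_def
proof (intro conjI ballI)
  show "0 \<in> G" using zero_in_C C_subset_G by blast
  fix x y assume "x \<in> G" "y \<in> G"
  then obtain j where "x \<in> scaled_Zgen m (b j)" "y \<in> scaled_Zgen m (b j)"
    using G_common by blast
  then show "x + y \<in> G" "- x \<in> G" 
    unfolding G_def using scaled_Zgen_closed(1,2)[of x m "b j"] by blast+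
qed

lemma G_nontrivial: "G \<noteq> {0}"
proof -
  have "1 \<in> G" using Zgen_nonneg_in_C[of 1] C_subset_G by auto
  then show ?thesis by auto
qed

lemma po_group_C: "po_group G C"
  unfolding po_group_def
proof (intro conjI ballI impI)
  fix x assume "x \<in> C" "- x \<in> C"
  then show "x = 0" using C_nonneg[of x] C_nonneg[of "- x"] by simp
qed (auto intro: subgroup_rat_G C_subset_G[THEN subsetD] zero_in_C C_add)

text \<open>Cofinality puts \<open>x\<close> below some \<open>h\<close> in \<open>Zgen m\<close>. A
  multiple of \<open>u\<close> lies in \<open>Zgen m\<close> too, and there the cone contains every
  nonnegative rational, so the Archimedean property finishes.\<close>

lemma order_unit_C:
  assumes "u \<in> C" "u \<noteq> 0"
  shows "order_unit G C u"
  unfolding order_unit_def pleq_def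
proof (intro conjI ballI)
  show "u \<in> C" by fact
  have u: "0 < u" using C_nonneg[OF assms(1)] assms(2) by simp
  obtain i where i: "of_nat (b i) * u \<in> Zgen m"
    using assms(1) cone_subset by (fastforce simp: C_def scaled_Zgen_def)
  fix x assume "x \<in> G"
  then have "- x \<in> G" using subgroup_rat_G unfolding subgroup_rat_def by blast
  then obtain j h where h: "h \<in> Zgen m" "- x + h \<in> P j"
    using cone_cofinal unfolding G_def by blast
  have bu: "0 < of_nat (b i) * u" using u b_pos by simp
  obtain l where l: "h < of_nat l * (of_nat (b i) * u)"
    using ex_less_of_nat_mult[OF bu] by blast
  have "of_nat l * (of_nat (b i) * u) - h \<in> C"
    using l by (intro Zgen_nonneg_in_C diff_in_Zgen of_nat_mult_in_Zgen[OF i] h(1)) auto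
  moreover have "- x + h \<in> C" using h(2) unfolding C_def by blast
  ultimately have "(of_nat l * (of_nat (b i) * u) - h) + (- x + h) \<in> C" by (rule C_add)
  then show "\<exists>n. of_nat n * u - x \<in> C" by (intro exI[of _ "l * b i"]) (simp add: mult_ac)
qed

lemma simple_group_C: "simple_group G C"
  unfolding simple_group_def using G_nontrivial order_unit_C by blast

lemma riesz_C: "riesz G C"
  unfolding riesz_def pleq_def
proof (intro ballI impI)
  fix x y1 y2 assume in_C: "x \<in> C" "y1 \<in> C" "y2 \<in> C" "y1 + y2 - x \<in> C"
  define w where "w = y1 + y2 - x"
  \<comment> \<open>The refinement property asks for strictly positive data, so zero entries are
    split by hand.\<close>
  consider "x = 0" | "y1 = 0" | "y2 = 0" | "w = 0" | "x > 0" "y1 > 0" "y2 > 0" "w > 0"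
    using in_C C_nonneg unfolding w_def by (metis order_le_less)
  then show "\<exists>x1\<in>C. \<exists>x2\<in>C. x = x1 + x2 \<and> y1 - x1 \<in> C \<and> y2 - x2 \<in> C"
  proof cases
    case 1
    then show ?thesis using in_C zero_in_C by (intro bexI[of _ 0]) auto
  next
    case 2
    then show ?thesis using in_C zero_in_C by (intro bexI[of _ 0] bexI[of _ x]) auto
  next
    case 3
    then show ?thesis using in_C zero_in_C by (intro bexI[of _ x] bexI[of _ 0]) auto
  next
    case 4
    then have "x = y1 + y2" by (simp add: w_def)
    then show ?thesis using in_C zero_in_C by (intro bexI[of _ y1] bexI[of _ y2]) auto
  next
    case 5
    obtain j1 where j1: "x \<in> P j1" "w \<in> P j1" using C_common in_C w_def by blast
    obtain j2 where j2: "y1 \<in> P j2" "y2 \<in> P j2" using C_common in_C by blast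
    define j where "j = max j1 j2"
    have j: "x \<in> P j" "w \<in> P j" "y1 \<in> P j" "y2 \<in> P j"
      using j1 j2 cone_le[of j1 j] cone_le[of j2 j] by (auto simp: j_def)
    have y2: "x + w - y1 = y2" by (simp add: w_def)
    \<comment> \<open>The equation refined is \<open>x + w = y1 + y2\<close>: the row of
      \<open>x\<close> is the splitting, the row of \<open>w\<close> witnesses the two
      inequalities.\<close>
    obtain i z where z: "z \<in> P i" "x - z \<in> P i" "y1 - z \<in> P i" "z + w - y1 \<in> P i"
      using refinement[of x j w y1] j 5 unfolding y2 by blast
    have "z + w - y1 = y2 - (x - z)" by (simp add: w_def)
    with z(4) have "y2 - (x - z) \<in> P i" by simp
    then have "z \<in> C" "x - z \<in> C" "y1 - z \<in> C" "y2 - (x - z) \<in> C"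
      using z(1-3) unfolding C_def by blast+
    then show ?thesis by (intro bexI[of _ z] bexI[of _ "x - z"]) auto
  qed
qed

lemma d_in_D: "d j \<in> D"
  unfolding D_def using d_in_C zero_in_C by (auto intro!: exI[of _ j])

lemma d_le_C: "i \<le> j \<Longrightarrow> d j - d i \<in> C"
  using d_le by (auto simp: C_def)

lemma interval_D: "interval G C D"
  unfolding interval_def pleq_def
proof (intro conjI ballI impI)
  show "D \<noteq> {}" using d_in_D by blast
  show "D \<subseteq> C" unfolding D_def by blast
  show "\<exists>z\<in>D. z - x \<in> C \<and> z - y \<in> C" if xy: "x \<in> D" "y \<in> D" for x y
  proof -
    obtain i j where ij: "d i - x \<in> C" "d j - y \<in> C" using xy unfolding D_def by blast
    have "d (max i j) - x \<in> C" "d (max i j) - y \<in> C"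
      using C_add[OF d_le_C[of i "max i j"] ij(1)] C_add[OF d_le_C[of j "max i j"] ij(2)] by auto
    then show ?thesis using d_in_D by blast
  qed
  show "y \<in> D" if xy: "x \<in> D" "y \<in> C" "x - y \<in> C" for x y
  proof -
    obtain i where "d i - x \<in> C" using xy(1) unfolding D_def by blast
    from C_add[OF this xy(3)] show ?thesis using xy(2) by (auto simp: D_def)
  qed
qed

lemma countably_generated_D: "countably_generated G C D"
  unfolding countably_generated_def pleq_def
proof (intro exI conjI ballI)
  show "countable (range d)" by simp
  show "range d \<subseteq> D" using d_in_D by blast
  show "\<exists>c\<in>range d. c - x \<in> C" if "x \<in> D" for x using that unfolding D_def by blast
qed

text \<open>In rank one a normalised state is determined: \<open>x = p / q\<close> gives
  \<open>q * s x = s p = p\<close>. Unboundedness thus reduces to the growth of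
  \<open>d\<close>.\<close>

lemma state_eq_of_rat:
  assumes "is_state G C 1 s" "x \<in> G" "0 \<le> x"
  shows "s x = of_rat x"
proof -
  have add: "s (u + v) = s u + s v" if "u \<in> G" "v \<in> G" for u v
    using assms(1) that unfolding is_state_def by blast
  have G0: "0 \<in> G" and Gadd: "\<And>u v. u \<in> G \<Longrightarrow> v \<in> G \<Longrightarrow> u + v \<in> G"
    using subgroup_rat_G unfolding subgroup_rat_def by blast+
  have s0: "s 0 = 0" using add[OF G0 G0] by simp
  have mult: "of_nat n * u \<in> G \<and> s (of_nat n * u) = of_nat n * s u" if u: "u \<in> G" for u n
  proof (induction n)
    case (Suc n)
    then show ?case using u add[of u "of_nat n * u"] Gadd[of u "of_nat n * u"]
      by (simp add: distrib_right)
  qed (simp add: s0 G0)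
  obtain p q :: int where pq: "x = of_int p / of_int q" "q > 0"
    by (metis quotient_of_denom_pos quotient_of_div surj_pair)
  have "p \<ge> 0" using pq assms(3) by (simp add: zero_le_divide_iff)
  define p' q' where "p' = nat p" and "q' = nat q"
  have x: "x = of_nat p' / of_nat q'" and q': "q' > 0"
    using pq \<open>p \<ge> 0\<close> by (simp_all add: p'_def q'_def)
  have "1 \<in> G" using Zgen_nonneg_in_C[of 1] C_subset_G by auto
  moreover have "s 1 = 1" using assms(1) unfolding is_state_def by blast
  ultimately have "s (of_nat p') = of_nat p'" using mult[of 1 p'] by simp
  moreover have "of_nat q' * x = of_nat p'" using q' unfolding x by simp
  ultimately have "of_nat q' * s x = of_nat p'" using mult[OF assms(2), of q'] by simp
  then have "s x = of_nat p' / of_nat q'" using q' by (simp add: field_simps)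
  then show ?thesis unfolding x by (simp add: of_rat_divide)
qed

lemma unbounded_interval_D: "unbounded_interval G C D"
  unfolding unbounded_interval_def
proof (intro exI conjI allI impI)
  show "order_unit G C 1" using Zgen_nonneg_in_C[of 1] by (intro order_unit_C) auto
  fix s M assume s: "is_state G C 1 s"
  obtain k where k: "M < real k" using reals_Archimedean2 by blast
  obtain j where "of_nat k < d j" using d_unbounded by blast
  then have "of_rat (of_nat k) < (of_rat (d j) :: real)" by (simp only: of_rat_less)
  then have "M < of_rat (d j)" using k by simp
  moreover have "s (d j) = of_rat (d j)"
    using d_in_C C_subset_G C_nonneg by (intro state_eq_of_rat[OF s]) auto
  ultimately show "\<exists>x\<in>D. M < s x" by (intro bexI[of _ "d j"] d_in_D) simp
qed

text \<open>At stage \<open>i\<close> the element is negative; afterwards \<open>gap\<close> with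
  \<open>g = n * d j - z\<close> carries non-membership to the next stage.\<close>

lemma multiple_of_d_misses:
  assumes "n \<le> i" "i \<le> j" "of_nat n * d i < of_nat z"
  shows "of_nat n * d j - of_nat z \<notin> P j"
  using assms(2)
proof (induction j rule: dec_induct)
  case base
  then show ?case using assms(3) cone_nonneg by force
next
  case (step j)
  have "d j \<in> scaled_Zgen m (b j)" using d_in_cone cone_subset by blast
  moreover have "of_nat z \<in> scaled_Zgen m (b j)" using Zgen_subset_scaled by force
  ultimately have in_G: "of_nat n * d j - of_nat z \<in> scaled_Zgen m (b j)"
    by (intro scaled_Zgen_closed(3) scaled_Zgen_closed(4))
  have eq: "of_nat n * d (Suc j) - of_nat z = of_nat n * d j - of_nat z + of_nat n * (d (Suc j) - d j)"
    by (simp add: algebra_simps)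
  have "n \<le> j" using assms(1) step.hyps(1) by simp
  moreover have "of_nat n * d j - of_nat z \<le> of_nat n * d j" by simp
  ultimately show ?case using gap[OF in_G] step.IH unfolding eq by blast
qed

text \<open>An integer \<open>z > n * d n\<close> is missed: any \<open>n\<close> elements of
  \<open>D\<close> lie below a common \<open>d J\<close>, so a sum dominating \<open>z\<close> would
  put \<open>n * d J - z\<close> into \<open>C\<close>.\<close>

lemma multiple_interval_D: "multiple_interval G C n D \<noteq> C"
proof
  assume eq: "multiple_interval G C n D = C"
  obtain z where z: "of_nat n * d n < of_nat z" using reals_Archimedean2 by blast
  have "of_nat z \<in> C" by (rule Zgen_nonneg_in_C) auto
  then have "of_nat z \<in> multiple_interval G C n D" using eq by simp
  then obtain xs where xs: "\<And>i. i < n \<Longrightarrow> xs i \<in> D" "(\<Sum>i<n. xs i) - of_nat z \<in> C"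
    unfolding multiple_interval_def pleq_def by blast
  have "\<forall>i. \<exists>j. i < n \<longrightarrow> d j - xs i \<in> C" using xs(1) unfolding D_def by blast
  then obtain f where f: "\<And>i. i < n \<Longrightarrow> d (f i) - xs i \<in> C" by metis
  \<comment> \<open>The sum bounds every \<open>f i\<close> at once; the summand \<open>n\<close>
    reaches the stages at which \<open>gap\<close> covers \<open>n\<close>.\<close>
  define J where "J = n + (\<Sum>i<n. f i)"
  have J: "d J - xs i \<in> C" if "i < n" for i
  proof -
    have "f i \<le> (\<Sum>i<n. f i)" using that by (intro member_le_sum) auto
    then have "d J - d (f i) \<in> C" by (intro d_le_C) (simp add: J_def)
    from C_add[OF this f[OF that]] show ?thesis by simp
  qed
  have "k \<le> n \<Longrightarrow> (\<Sum>i<k. d J - xs i) \<in> C" for k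
  proof (induction k)
    case (Suc k)
    then show ?case using C_add[OF Suc.IH J[of k]] by simp
  qed (simp add: zero_in_C)
  from C_add[OF this[OF order_refl] xs(2)] have "of_nat n * d J - of_nat z \<in> C"
    by (simp add: sum_subtractf)
  then obtain i where i: "of_nat n * d J - of_nat z \<in> P i" unfolding C_def by blast
  \<comment> \<open>\<open>multiple_of_d_misses\<close> speaks of one index for \<open>d\<close> and
    the cone, so \<open>d J\<close> is raised to \<open>d j\<close>.\<close>
  define j where "j = max i J"
  have "of_nat n * d J - of_nat z \<in> P j" using i cone_le[of i j] by (auto simp: j_def)
  moreover have "d j - d J \<in> P j" by (rule d_le) (simp add: j_def)
  then have "of_nat k * (d j - d J) \<in> P j" for k
    by (induction k) (auto simp: zero_in_cone distrib_right intro: cone_add)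
  ultimately have "of_nat n * d J - of_nat z + of_nat n * (d j - d J) \<in> P j" by (rule cone_add)
  then have "of_nat n * d j - of_nat z \<in> P j" by (simp add: algebra_simps)
  moreover have "n \<le> j" by (simp add: j_def J_def)
  ultimately show False using multiple_of_d_misses[OF order_refl _ z, of j] by blast
qed

text \<open>Each prime gets its multiplicity either from the \<open>b j\<close> or from
  \<open>m\<close>. For the converse inclusion, one \<open>j\<close> absorbs the part of
  \<open>q\<close> outside the support of \<open>m\<close>, as \<open>q\<close> has finitely many
  primes.\<close>

lemma G_eq_Zgen:
  assumes supp: "\<And>p j. prime p \<Longrightarrow> p dvd b j \<Longrightarrow> m p = 0"
  shows "G = Zgen (gmult (\<lambda>p. SUP j. enat (multiplicity p (b j))) m)" (is "_ = Zgen (gmult ?N m)")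
proof (intro set_eqI iffI)
  fix x assume "x \<in> G"
  then obtain j where j: "of_nat (b j) * x \<in> Zgen m" by (auto simp: G_def scaled_Zgen_def)
  obtain r q where rq: "of_nat (b j) * x = of_int r / of_nat q" "q > 0"
    "\<And>p. prime p \<Longrightarrow> enat (multiplicity p q) \<le> m p" using ZgenE[OF j] by metis
  show "x \<in> Zgen (gmult ?N m)"
  proof (rule ZgenI)
    have "x = (of_nat (b j) * x) / of_nat (b j)" using b_pos[of j] by simp
    also have "\<dots> = of_int r / of_nat (b j * q)" unfolding rq(1) by (simp add: mult.commute)
    finally show "x = of_int r / of_nat (b j * q)" .
    show "0 < b j * q" using b_pos rq(2) by simp
    fix p :: nat assume p: "prime p"
    have "enat (multiplicity p (b j * q)) = enat (multiplicity p (b j)) + enat (multiplicity p q)"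
      using b_pos[of j] rq(2) p by (subst prime_elem_multiplicity_mult_distrib) auto
    also have "\<dots> \<le> ?N p + m p" using rq(3)[OF p] by (intro add_mono SUP_upper) auto
    finally show "enat (multiplicity p (b j * q)) \<le> gmult ?N m p" by (simp add: gmult_def)
  qed
next
  fix x assume "x \<in> Zgen (gmult ?N m)"
  then obtain r q where x: "x = of_int r / of_nat q" "q > 0"
    and q: "\<And>p. prime p \<Longrightarrow> enat (multiplicity p q) \<le> ?N p + m p"
    unfolding gmult_def by (rule ZgenE) blast
  have "\<exists>j. multiplicity p q \<le> multiplicity p (b j)" if p: "prime p" "m p = 0" for p
  proof (rule ccontr)
    assume "\<nexists>j. multiplicity p q \<le> multiplicity p (b j)"
    then have *: "Suc (multiplicity p (b j)) \<le> multiplicity p q" for j by (simp add: not_le Suc_le_eq)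
    \<comment> \<open>Multiplicities are integers: if all stay below that of \<open>q\<close>, so
      does their supremum.\<close>
    have "?N p \<le> enat (multiplicity p q - 1)"
    proof (rule SUP_least)
      fix j show "enat (multiplicity p (b j)) \<le> enat (multiplicity p q - 1)" using *[of j] by simp
    qed
    moreover have "enat (multiplicity p q) \<le> ?N p" using q[OF p(1)] p(2) by simp
    ultimately have "enat (multiplicity p q) \<le> enat (multiplicity p q - 1)" by (rule order_trans[rotated])
    then show False using *[of 0] by simp
  qed
  then obtain f where f: "\<And>p. prime p \<Longrightarrow> m p = 0 \<Longrightarrow> multiplicity p q \<le> multiplicity p (b (f p))"
    by metis
  define j where "j = (\<Sum>p\<in>prime_factors q. f p)"
  have bf: "multiplicity p q \<le> multiplicity p (b j)" if p: "prime p" "m p = 0" for p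
  proof (cases "p dvd q")
    case True
    then have "f p \<le> j" unfolding j_def using p x(2)
      by (intro member_le_sum) (auto simp: prime_factors_dvd)
    then have "b (f p) dvd b j" by (rule b_dvd)
    then have "multiplicity p (b (f p)) \<le> multiplicity p (b j)"
      using b_pos[of j] by (intro dvd_imp_multiplicity_le) auto
    then show ?thesis using f[OF p] by simp
  qed (simp add: not_dvd_imp_multiplicity_0)
  \<comment> \<open>The part \<open>q'\<close> of \<open>q\<close> that \<open>b j\<close> does not
    cancel is supported where \<open>m\<close> is nonzero.\<close>
  define g where "g = gcd q (b j)"
  have "g dvd q" "g dvd b j" by (simp_all add: g_def)
  then obtain q' b' where q': "q = g * q'" and b': "b j = g * b'" by (auto elim!: dvdE)
  have pos: "g > 0" "q' > 0" using x(2) unfolding q' by auto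
  have "of_nat (b j) * x \<in> Zgen m"
  proof (rule ZgenI)
    show "of_nat (b j) * x = of_int (r * int b') / of_nat q'"
      using pos unfolding x(1) b' unfolding q' by simp
    show "q' > 0" by fact
    fix p :: nat assume p: "prime p"
    have mq: "multiplicity p q = multiplicity p g + multiplicity p q'"
      using pos p unfolding q' by (subst prime_elem_multiplicity_mult_distrib) auto
    show "enat (multiplicity p q') \<le> m p"
    proof (cases "m p = 0")
      case True
      have "multiplicity p g = min (multiplicity p q) (multiplicity p (b j))"
        unfolding g_def using x(2) b_pos[of j] p by (subst multiplicity_gcd) auto
      then have "multiplicity p q' = 0" using mq bf[OF p True] by simp
      then show ?thesis by (simp add: zero_enat_def[symmetric])
    next
      case False
      then have "multiplicity p (b i) = 0" for i 
        using supp[OF p] not_dvd_imp_multiplicity_0 by blast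
      then have "?N p = 0" by (simp add: zero_enat_def[symmetric])
      then have "enat (multiplicity p q) \<le> m p" using q[OF p] by simp
      moreover have "enat (multiplicity p q') \<le> enat (multiplicity p q)" using mq by simp
      ultimately show ?thesis by (rule order_trans[rotated])
    qed
  qed
  then show "x \<in> G" by (auto simp: G_def scaled_Zgen_def)
qed

end

section \<open>Existence of the tower by dependent choice\<close>

lemma cone_tower_exists:
  assumes "strict_mono A" "gcoprime m (seq_gint A)"
  obtains b P d where "cone_tower m b P d"
    "\<And>p j. prime p \<Longrightarrow> enat (multiplicity p (b j)) \<le> seq_gint A p"
proof -
  txt \<open>Every triple has to recur, since it may be admissible only from some stage on, and since the
    infinitely many occurrences of \<open>(1, 1, 1)\<close> are what makes \<open>d\<close> unbounded.\<close>
  define task :: "nat \<Rightarrow> rat \<times> rat \<times> rat" where "task n = from_nat (fst (prod_decode n))" for n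
  have task_recurs: "\<exists>n\<ge>j. task n = \<tau>" for j \<tau>
    by (rule exI[of _ "prod_encode (to_nat \<tau>, j)"]) (simp add: task_def le_prod_encode_2)
  \<comment> \<open>\<open>N\<close> is both the number of the task and the bound on the protected
    multiples, so each \<open>n\<close> is protected at all stages from \<open>n\<close> on.\<close>
  define Q :: "nat \<Rightarrow> nat \<times> nat \<times> rat set \<times> rat \<Rightarrow> nat \<times> nat \<times> rat set \<times> rat \<Rightarrow> bool" where
    "Q = (\<lambda>N (b, t, P, d) (b', t', P', d'). b dvd b' \<and> P \<subseteq> P' \<and> d' - d \<in> P' \<and>
      (\<forall>x1 x2 y1. task N = (x1, x2, y1) \<and> x1 \<in> P \<and> x2 \<in> P \<and> y1 \<in> P \<and> x1 + x2 - y1 \<in> P \<and>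
         0 < x1 \<and> 0 < x2 \<and> 0 < y1 \<and> 0 < x1 + x2 - y1 \<longrightarrow>
         (\<exists>z\<in>P'. x1 - z \<in> P' \<and> y1 - z \<in> P' \<and> z + x2 - y1 \<in> P')) \<and>
      (task N = (1, 1, 1) \<longrightarrow> d + 1 / 3 \<le> d') \<and>
      (\<forall>g n. g \<in> scaled_Zgen m b \<longrightarrow> n \<le> N \<longrightarrow> g \<le> of_nat n * d \<longrightarrow>
         g + of_nat n * (d' - d) \<in> P' \<longrightarrow> g \<in> P))"
  define S :: "nat \<times> nat \<times> rat set \<times> rat \<Rightarrow> bool" where "S = (\<lambda>(b, t, P, d). cone_stage m A b t P d)"
  have "\<exists>f. \<forall>n. S (f n) \<and> Q n (f n) (f (Suc n))"
  proof (rule dependent_nat_choice)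
    show "\<exists>s. S s" using cone_stage_initial[of m A] unfolding S_def by blast
    fix s N assume "S s"
    obtain b t P d where s: "s = (b, t, P, d)" by (cases s)
    have st: "cone_stage m A b t P d" using \<open>S s\<close> by (simp add: S_def s)
    then have "1 \<in> P" unfolding cone_stage_def by force
    obtain u1 u2 v1 where u: "task N = (u1, u2, v1)" by (cases "task N")
    define valid where "valid \<longleftrightarrow> u1 \<in> P \<and> u2 \<in> P \<and> v1 \<in> P \<and> u1 + u2 - v1 \<in> P \<and>
      0 < u1 \<and> 0 < u2 \<and> 0 < v1 \<and> 0 < u1 + u2 - v1"
    \<comment> \<open>An inadmissible task is replaced by \<open>(1, 1, 1)\<close>, so that a step
      is always possible.\<close>
    obtain x1 x2 y1 where x: "x1 \<in> P" "x2 \<in> P" "y1 \<in> P" "x1 + x2 - y1 \<in> P"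
      "0 < x1" "0 < x2" "0 < y1" "0 < x1 + x2 - y1" "valid \<Longrightarrow> (x1, x2, y1) = (u1, u2, v1)"
    proof (cases valid)
      case True
      then show ?thesis using that[of u1 u2 v1] by (simp add: valid_def)
    next
      case False
      then show ?thesis using that[of 1 1 1] \<open>1 \<in> P\<close> by simp
    qed
    obtain b' t' P' d' z where *: "cone_stage m A b' t' P' d'" "b dvd b'" "P \<subseteq> P'" "d' - d \<in> P'"
      "z \<in> P'" "x1 - z \<in> P'" "y1 - z \<in> P'" "z + x2 - y1 \<in> P'"
      "x2 = y1 \<Longrightarrow> d + min x1 y1 / 3 \<le> d'"
      "\<And>g n. g \<in> scaled_Zgen m b \<Longrightarrow> n \<le> N \<Longrightarrow> g \<le> of_nat n * d \<Longrightarrow>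
         g + of_nat n * (d' - d) \<in> P' \<Longrightarrow> g \<in> P"
      using cone_stage_extend[OF assms st x(1-8), where N = N] by metis
    have "\<exists>z\<in>P'. u1 - z \<in> P' \<and> v1 - z \<in> P' \<and> z + u2 - v1 \<in> P'" if valid
      using *(5-8) x(9)[OF that] by auto
    then have "\<forall>x1 x2 y1. task N = (x1, x2, y1) \<and> x1 \<in> P \<and> x2 \<in> P \<and> y1 \<in> P \<and> x1 + x2 - y1 \<in> P \<and>
         0 < x1 \<and> 0 < x2 \<and> 0 < y1 \<and> 0 < x1 + x2 - y1 \<longrightarrow>
         (\<exists>z\<in>P'. x1 - z \<in> P' \<and> y1 - z \<in> P' \<and> z + x2 - y1 \<in> P')"
      unfolding u valid_def by blast
    moreover have "d + 1 / 3 \<le> d'" if "task N = (1, 1, 1)"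
    proof -
      have "valid" using that \<open>1 \<in> P\<close> by (simp add: valid_def u)
      then show ?thesis using x(9) that *(9) by (simp add: u)
    qed
    ultimately have "Q N s (b', t', P', d')"
      unfolding Q_def s prod.case using *(2-4,10) by (intro conjI) blast+
    then show "\<exists>s'. S s' \<and> Q N s s'" using *(1) unfolding S_def by blast
  qed
  then obtain f where f: "\<And>n. S (f n)" "\<And>n. Q n (f n) (f (Suc n))" by blast
  define b where "b = (\<lambda>n. fst (f n))"
  define t where "t = (\<lambda>n. fst (snd (f n)))"
  define P where "P = (\<lambda>n. fst (snd (snd (f n))))"
  define d where "d = (\<lambda>n. snd (snd (snd (f n))))"
  have f_eq: "f n = (b n, t n, P n, d n)" for n by (simp add: b_def t_def P_def d_def)
  have st: "cone_stage m A (b n) (t n) (P n) (d n)" for n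
    using f(1)[of n] by (simp add: f_eq S_def)
  note Q = f(2)[unfolded Q_def f_eq prod.case]
  have P_Suc: "P n \<subseteq> P (Suc n)" and d_Suc: "d (Suc n) - d n \<in> P (Suc n)"
    and b_Suc: "b n dvd b (Suc n)" for n using Q[of n] by blast+
  have nonneg: "0 \<le> x" if "x \<in> P n" for x n using st[of n] that unfolding cone_stage_def by blast
  have d_mono: "d i \<le> d j" if "i \<le> j" for i j
    by (rule lift_Suc_mono_le[OF _ that]) (use nonneg[OF d_Suc] in simp)
  have P_le: "P i \<subseteq> P j" if "i \<le> j" for i j
    by (rule lift_Suc_mono_le[of P, OF P_Suc that])
  have "\<exists>j. of_nat k / 3 \<le> d j" for k
  proof (induction k)
    case 0
    have "d 0 \<in> P 0" using st[of 0] unfolding cone_stage_def by blast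
    then show ?case using nonneg by auto
  next
    case (Suc k)
    then obtain j where j: "of_nat k / 3 \<le> d j" by blast
    obtain n where n: "n \<ge> j" "task n = (1, 1, 1)" using task_recurs by blast
    have "d n + 1 / 3 \<le> d (Suc n)" using Q[of n] n(2) by blast
    then have "of_nat (Suc k) / 3 \<le> d (Suc n)" using j d_mono[OF n(1)] by simp
    then show ?case by blast
  qed
  note d_large = this
  have "cone_tower m b P d"
  proof
    fix j
    show "b j > 0" "P j \<subseteq> scaled_Zgen m (b j)" "d j \<in> P j"
      using st[of j] unfolding cone_stage_def by blast+
    show "b j dvd b (Suc j)" "P j \<subseteq> P (Suc j)" "d (Suc j) - d j \<in> P (Suc j)"
      by (fact b_Suc P_Suc d_Suc)+
    show "x \<in> P j \<Longrightarrow> 0 \<le> x" "x \<in> P j \<Longrightarrow> y \<in> P j \<Longrightarrow> x + y \<in> P j"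
      "x \<in> Zgen m \<Longrightarrow> 0 \<le> x \<Longrightarrow> x \<in> P j"
      "x \<in> scaled_Zgen m (b j) \<Longrightarrow> \<exists>h\<in>Zgen m. x + h \<in> P j" for x y
      using st[of j] unfolding cone_stage_def by blast+
  next
    fix x1 x2 y1 j
    assume x: "x1 \<in> P j" "x2 \<in> P j" "y1 \<in> P j" "x1 + x2 - y1 \<in> P j"
      "0 < x1" "0 < x2" "0 < y1" "0 < x1 + x2 - y1"
    obtain n where n: "n \<ge> j" "task n = (x1, x2, y1)" using task_recurs by blast
    have "x1 \<in> P n" "x2 \<in> P n" "y1 \<in> P n" "x1 + x2 - y1 \<in> P n" using x P_le[OF n(1)] by blast+
    then have "\<exists>z\<in>P (Suc n). x1 - z \<in> P (Suc n) \<and> y1 - z \<in> P (Suc n) \<and> z + x2 - y1 \<in> P (Suc n)"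
      using Q[of n] n(2) x(5-8) by blast
    then show "\<exists>i. \<exists>z\<in>P i. x1 - z \<in> P i \<and> y1 - z \<in> P i \<and> z + x2 - y1 \<in> P i" by blast
  next
    fix k
    \<comment> \<open>The extra 1 makes the inequality strict.\<close>
    obtain j where "of_nat (3 * k + 1) / 3 \<le> d j" using d_large by blast
    then have "of_nat k < d j" by simp
    then show "\<exists>j. of_nat k < d j" by blast
  next
    fix g j n assume "g \<in> scaled_Zgen m (b j)" "n \<le> j" "g \<le> of_nat n * d j"
      "g + of_nat n * (d (Suc j) - d j) \<in> P (Suc j)"
    then show "g \<in> P j" using Q[of j] by blast
  qed
  moreover have "enat (multiplicity p (b j)) \<le> seq_gint A p" if "prime p" for p j
    using st[of j] that partial_sum_le_seq_gint unfolding cone_stage_def by (meson order_trans)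
  ultimately show ?thesis by (rule that)
qed

theorem theorem5p2:
  fixes A :: "nat \<Rightarrow> nat" and m :: gint
  assumes "strict_mono A"
    and "gcoprime m (seq_gint A)"
  shows "\<exists>G P. po_group G P \<and> simple_group G P \<and> riesz G P \<and> rank_one G \<and>
           (\<exists>D. interval G P D \<and> countably_generated G P D \<and> unbounded_interval G P D \<and>
                (\<forall>n\<ge>1. multiple_interval G P n D \<noteq> P)) \<and>
           (\<exists>N. gdvd N (seq_gint A) \<and> (\<exists>f. add_group_iso f G (Zgen (gmult N m))))"
proof -
  obtain b P d where "cone_tower m b P d"
    and b: "\<And>p j. prime p \<Longrightarrow> enat (multiplicity p (b j)) \<le> seq_gint A p"
    using cone_tower_exists[OF assms] by blast
  then interpret cone_tower m b P d by simp
  \<comment> \<open>The value is infinite where the powers of \<open>p\<close> in the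
    \<open>b j\<close> are unbounded; the bound on each \<open>b j\<close> passes to the supremum
    and gives a divisor of \<open>seq_gint A\<close>.\<close>
  define N where "N = (\<lambda>p. SUP j. enat (multiplicity p (b j)))"
  have "m p = 0" if p: "prime p" "p dvd b j" for p j
  proof -
    have "0 < enat (multiplicity p (b j))"
      using p b_pos[of j] by (simp add: zero_enat_def prime_multiplicity_gt_zero_iff)
    then have "seq_gint A p \<noteq> 0" using b[OF p(1), of j] by auto
    then show ?thesis using assms(2) p(1) unfolding gcoprime_def by blast
  qed
  then have "G = Zgen (gmult N m)" unfolding N_def by (rule G_eq_Zgen)
  then have "add_group_iso id G (Zgen (gmult N m))" by (simp add: add_group_iso_def)
  moreover have "gdvd N (seq_gint A)"
    unfolding gdvd_iff N_def using b by (auto intro: SUP_least)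
  moreover have "rank_one G" using subgroup_rat_G G_nontrivial by (simp add: rank_one_def)
  ultimately show ?thesis
    using po_group_C simple_group_C riesz_C interval_D countably_generated_D
      unbounded_interval_D multiple_interval_D by blast
qed

end
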